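(* Let $\mathcal{A}$ be a lazy paging algorithm. If $\mathcal{A}$ conforms to a family $\{\preceq_\sigma\}$ that is monotone and self-similar, then $\mathcal{A}$ is stable.
   Context: $\mathcal{U}$ is a totally ordered universe of items. $\mathcal{A}_k$ is paging algorithm $\mathcal{A}$ on an initially empty cache of size $k$; $\mathcal{A}_k(\sigma)$ is the set of cached items after serving $\sigma$; $\textsf{Out}(\mathcal{A}_k,\tau,z):=\mathcal{A}_k(\tau)\setminus\mathcal{A}_k(\tau z)$; for $X\subseteq\mathcal{U}$, $\sigma[X]$ is the subsequence of $\sigma$ of requests to items in $X$. Lazy: fetches only on a miss, evicts at most one item per miss, and only when full. $\{\preceq_\sigma\}_{\sigma\in\mathcal{U}^*}$ is a family of total orders on $\mathcal{U}$. $\mathcal{A}$ conforms to it if for every $\tau$, $z$, $k$: whenever $x\in\mathcal{A}_k(\tau)\setminus\textsf{Out}(\mathcal{A}_k,\tau,z)$ and $y\in\textsf{Out}(\mathcal{A}_k,\tau,z)$, then $x\preceq_{\tau z}y$. Monotone: for every $\sigma$ and items $x,y,z$ appearing in $\sigma$ with $y\neq z$, $x\preceq_\sigma y$ implies $x\preceq_{\sigma z}y$. Self-similar: for every $\sigma$, $X\subseteq\mathcal{U}$, and items $x,y$ appearing in $\sigma[X]$, $x\preceq_{\sigma[X]}y$ implies $x\preceq_\sigma y$. Stable: for every $\tau\in\mathcal{U}^*$, $X\subseteq\mathcal{U}$, $z\in X$, integers $a>b\ge1$, $\textsf{Out}(\mathcal{A}_b,\tau[X],z)\cap\mathcal{A}_a(\tau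 z)\neq\emptyset$ implies $\mathcal{A}_b(\tau[X]z)\subseteq\mathcal{A}_a(\tau z)$. *)

theory Defs
  imports Main
begin

text \<open>
  An algorithm is a map \<open>A\<close>, where \<open>A k \<sigma>\<close> is the set of items held by a cache of size \<open>k\<close>,
  initially empty, after serving \<open>\<sigma>\<close>. The universe of items is the type \<open>'a\<close>. Cache sizes are
  positive, since a cache of size 0 cannot serve a request.
\<close>

type_synonym 'a paging = "nat \<Rightarrow> 'a list \<Rightarrow> 'a set"

definition paging_algorithm :: "'a::linorder paging \<Rightarrow> bool" where
  "paging_algorithm A \<longleftrightarrow>
     (\<forall>k\<ge>1. A k [] = {} \<and>
        (\<forall>\<sigma>. finite (A k \<sigma>) \<and> card (A k \<sigma>) \<le> k) \<and>
        (\<forall>\<sigma> z. z \<in> A k (\<sigma> @ [z])))"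

definition Out :: "('a list \<Rightarrow> 'a set) \<Rightarrow> 'a list \<Rightarrow> 'a \<Rightarrow> 'a set" where
  "Out C \<tau> z = C \<tau> - C (\<tau> @ [z])"

definition Fetched :: "('a list \<Rightarrow> 'a set) \<Rightarrow> 'a list \<Rightarrow> 'a \<Rightarrow> 'a set" where
  "Fetched C \<tau> z = C (\<tau> @ [z]) - C \<tau>"

text \<open>
  A miss fetches the requested item only (no prefetching), and a hit leaves the cache unchanged.
\<close>

definition lazy :: "'a::linorder paging \<Rightarrow> bool" where
  "lazy A \<longleftrightarrow>
     (\<forall>k\<ge>1. \<forall>\<tau> z.
        (z \<in> A k \<tau> \<longrightarrow> Fetched (A k) \<tau> z = {} \<and> Out (A k) \<tau> z = {}) \<and>
        (z \<notin> A k \<tau> \<longrightarrow> Fetched (A k) \<tau> z \<subseteq> {z} \<and> card (Out (A k) \<tau> z) \<le> 1) \<and>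
        (Out (A k) \<tau> z \<noteq> {} \<longrightarrow> card (A k \<tau>) = k))"

definition restrict_seq :: "'a list \<Rightarrow> 'a set \<Rightarrow> 'a list" where
  "restrict_seq \<sigma> X = filter (\<lambda>x. x \<in> X) \<sigma>"

text \<open>
  In a family \<open>R\<close> of orders, \<open>(x, y) \<in> R \<sigma>\<close> stands for \<open>x \<preceq>\<^sub>\<sigma> y\<close>.
\<close>

definition total_order_family :: "('a::linorder list \<Rightarrow> 'a rel) \<Rightarrow> bool" where
  "total_order_family R \<longleftrightarrow> (\<forall>\<sigma>. linear_order_on UNIV (R \<sigma>))"

definition conforms :: "'a::linorder paging \<Rightarrow> ('a list \<Rightarrow> 'a rel) \<Rightarrow> bool" where
  "conforms A R \<longleftrightarrow>
     (\<forall>\<tau> z. \<forall>k\<ge>1. \<forall>x y.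
        x \<in> A k \<tau> - Out (A k) \<tau> z \<longrightarrow> y \<in> Out (A k) \<tau> z \<longrightarrow> (x, y) \<in> R (\<tau> @ [z]))"

definition monotone_family :: "('a::linorder list \<Rightarrow> 'a rel) \<Rightarrow> bool" where
  "monotone_family R \<longleftrightarrow>
     (\<forall>\<sigma>. \<forall>x\<in>set \<sigma>. \<forall>y\<in>set \<sigma>. \<forall>z\<in>set \<sigma>.
        y \<noteq> z \<longrightarrow> (x, y) \<in> R \<sigma> \<longrightarrow> (x, y) \<in> R (\<sigma> @ [z]))"

definition self_similar :: "('a::linorder list \<Rightarrow> 'a rel) \<Rightarrow> bool" where
  "self_similar R \<longleftrightarrow>
     (\<forall>\<sigma> X. \<forall>x\<in>set (restrict_seq \<sigma> X). \<forall>y\<in>set (restrict_seq \<sigma> X).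
        (x, y) \<in> R (restrict_seq \<sigma> X) \<longrightarrow> (x, y) \<in> R \<sigma>)"

definition stable_paging :: "'a::linorder paging \<Rightarrow> bool" where
  "stable_paging A \<longleftrightarrow>
     (\<forall>\<tau> X. \<forall>z\<in>X. \<forall>a b. b \<ge> 1 \<longrightarrow> a > b \<longrightarrow>
        Out (A b) (restrict_seq \<tau> X) z \<inter> A a (\<tau> @ [z]) \<noteq> {} \<longrightarrow>
        A b (restrict_seq \<tau> X @ [z]) \<subseteq> A a (\<tau> @ [z]))"

end

theory Submission
  imports Defs
begin

text \<open>
  Suppose \<open>x\<close> has been requested in \<open>\<sigma>\<close> but is not cached. Then at most one cached item exceeds \<open>x\<close>
  in \<open>\<preceq>\<^sub>\<sigma>\<close>: when \<open>x\<close> is evicted only the incoming item can exceed it, monotonicity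
  keeps the items below \<open>x\<close> there, and every later miss evicts the item above \<open>x\<close>, if there is one.

  Let \<open>y\<close> be evicted by \<open>A b\<close> at \<open>\<tau>[X] z\<close> but kept by \<open>A a\<close>, and suppose that \<open>x\<close> is kept by \<open>A b\<close>
  but missing from \<open>A a\<close>. Then \<open>x\<close> is below \<open>y\<close>, so \<open>y\<close> is the one item of \<open>A a\<close> above \<open>x\<close>; a miss
  of \<open>A a\<close> on \<open>z\<close> would have evicted it, so \<open>z\<close> is a hit and lies below \<open>x\<close>. Thus \<open>x\<close> and \<open>y\<close> are two
  items of \<open>A b\<close> above \<open>z\<close>, which has been requested and is not in \<open>A b\<close>, a contradiction.
\<close>

locale monotone_conforming_paging =
  fixes A :: "'a::linorder paging" and R :: "'a list \<Rightarrow> 'a rel"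
  assumes paging: "paging_algorithm A"
    and lazy: "lazy A"
    and orders: "total_order_family R"
    and conf: "conforms A R"
    and mono: "monotone_family R"
    and similar: "self_similar R"
begin

lemma order_antisym: "(x, y) \<in> R \<sigma> \<Longrightarrow> (y, x) \<in> R \<sigma> \<Longrightarrow> x = y"
  using orders unfolding total_order_family_def order_on_defs by (meson antisymD)

lemma order_trans: "(x, y) \<in> R \<sigma> \<Longrightarrow> (y, z) \<in> R \<sigma> \<Longrightarrow> (x, z) \<in> R \<sigma>"
  using orders unfolding total_order_family_def order_on_defs by (meson transD)

lemma order_total: "(x, y) \<in> R \<sigma> \<or> (y, x) \<in> R \<sigma>"
proof (cases "x = y")
  case True
  then show ?thesis
    using orders unfolding total_order_family_def order_on_defs by (meson UNIV_I refl_onD)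
next
  case False
  then show ?thesis
    using orders unfolding total_order_family_def order_on_defs total_on_def by blast
qed

text \<open>Self-similarity is one direction. If the other failed, totality would give the reverse
  comparison for the restricted sequence, which transfers to \<sigma>, and antisymmetry then leaves
  only \<open>x = y\<close>.\<close>

lemma order_restrict:
  assumes "x \<in> set (restrict_seq \<sigma> X)" "y \<in> set (restrict_seq \<sigma> X)"
  shows "(x, y) \<in> R (restrict_seq \<sigma> X) \<longleftrightarrow> (x, y) \<in> R \<sigma>"
proof -
  have imp: "(u, v) \<in> R \<sigma>" if "(u, v) \<in> R (restrict_seq \<sigma> X)"
    "u \<in> set (restrict_seq \<sigma> X)" "v \<in> set (restrict_seq \<sigma> X)" for u v
    using similar that unfolding self_similar_def by blast
  show ?thesis
    using imp[of x y] imp[of y x] assms order_total[of x y "restrict_seq \<sigma> X"]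
      order_antisym[of x y \<sigma>] by blast
qed

lemma order_append:
  assumes "x \<in> set \<sigma>" "y \<in> set \<sigma>" "y \<noteq> z" "(x, y) \<in> R \<sigma>"
  shows "(x, y) \<in> R (\<sigma> @ [z])"
proof (cases "z \<in> set \<sigma>")
  case True
  then show ?thesis using mono assms unfolding monotone_family_def by blast
next
  \<comment> \<open>Monotonicity says nothing about a new \<open>z\<close>, but then \<open>\<sigma>\<close> is a restriction of \<open>\<sigma> z\<close>.\<close>
  case False
  then have "restrict_seq (\<sigma> @ [z]) (set \<sigma>) = \<sigma>" by (simp add: restrict_seq_def)
  then show ?thesis using order_restrict[of x "\<sigma> @ [z]" "set \<sigma>" y] assms by simp
qed

context
  fixes k :: nat
  assumes k: "k \<ge> 1"
begin

lemma cache_empty: "A k [] = {}"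
  and cache_finite: "finite (A k \<sigma>)"
  and cache_card: "card (A k \<sigma>) \<le> k"
  and cache_requested: "z \<in> A k (\<sigma> @ [z])"
  using paging k unfolding paging_algorithm_def by auto

lemma cache_append_subset: "A k (\<sigma> @ [z]) \<subseteq> insert z (A k \<sigma>)"
  using lazy k unfolding lazy_def Fetched_def by blast

lemma cache_subset_set: "A k \<sigma> \<subseteq> set \<sigma>"
proof (induction \<sigma> rule: rev_induct)
  case Nil
  then show ?case by (simp add: cache_empty)
next
  case (snoc z \<sigma>)
  then show ?case using cache_append_subset[of \<sigma> z] by auto
qed

lemma cache_hit: "z \<in> A k \<sigma> \<Longrightarrow> A k (\<sigma> @ [z]) = A k \<sigma>"
  using lazy k unfolding lazy_def Fetched_def Out_def by blast

lemma cache_evict: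
  assumes "e \<in> A k \<sigma>" "e \<notin> A k (\<sigma> @ [z])"
  shows "z \<notin> A k \<sigma>" "A k (\<sigma> @ [z]) = insert z (A k \<sigma> - {e})" "card (A k \<sigma>) = k"
proof -
  show z: "z \<notin> A k \<sigma>" using assms cache_hit by blast
  have e: "e \<in> Out (A k) \<sigma> z" using assms by (simp add: Out_def)
  \<comment> \<open>\<open>card\<close> is 0 on infinite sets, so the bound by 1 pins down the
    victim only once finiteness is known.\<close>
  have fin: "finite (Out (A k) \<sigma> z)" using cache_finite by (simp add: Out_def)
  have "card (Out (A k) \<sigma> z) \<le> 1" using lazy k z unfolding lazy_def by blast
  then have "Out (A k) \<sigma> z = {e}" using e fin card_le_Suc0_iff_eq[OF fin] by auto
  then show "A k (\<sigma> @ [z]) = insert z (A k \<sigma> - {e})"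
    using cache_append_subset[of \<sigma> z] cache_requested[of z \<sigma>] unfolding Out_def by blast
  show "card (A k \<sigma>) = k" using e lazy k unfolding lazy_def by blast
qed

text \<open>Conformity bounds only items cached before the request; the incoming \<open>z\<close>
  may lie above the victim.\<close>

lemma order_evict:
  assumes "e \<in> A k \<sigma>" "e \<notin> A k (\<sigma> @ [z])" "u \<in> A k \<sigma>" "u \<noteq> e"
  shows "(u, e) \<in> R (\<sigma> @ [z])"
proof -
  have "u \<in> A k (\<sigma> @ [z])" using cache_evict(2)[OF assms(1,2)] assms(3,4) by blast
  then show ?thesis using conf k assms unfolding conforms_def Out_def by blast
qed

lemma full_miss_evicts:
  assumes "card (A k \<sigma>) = k" "z \<notin> A k \<sigma>"
  obtains e where "e \<in> A k \<sigma>" "e \<notin> A k (\<sigma> @ [z])"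
proof -
  have "\<not> A k \<sigma> \<subseteq> A k (\<sigma> @ [z])"
  proof
    assume "A k \<sigma> \<subseteq> A k (\<sigma> @ [z])"
    then have "card (insert z (A k \<sigma>)) \<le> card (A k (\<sigma> @ [z]))"
      using cache_requested cache_finite by (intro card_mono) auto
    then show False using assms cache_finite cache_card[of "\<sigma> @ [z]"] by simp
  qed
  then show thesis using that by blast
qed

text \<open>A requested item that is missing was evicted at some point, which happens only from a
  full cache. From then on the cache stays full: a hit changes nothing and a miss swaps one item for
  another.\<close>

lemma full_if_missing:
  "x \<in> set \<sigma> \<Longrightarrow> x \<notin> A k \<sigma> \<Longrightarrow> card (A k \<sigma>) = k"
proof (induction \<sigma> rule: rev_induct)
  case Nil
  then show ?case by simp
next
  case (snoc z \<sigma>)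
  have x: "x \<in> set \<sigma>" using snoc.prems cache_requested by auto
  have full: "card (A k \<sigma>) = k" using snoc x cache_evict(3) by (cases "x \<in> A k \<sigma>") auto
  show ?case
  proof (cases "z \<in> A k \<sigma>")
    case True
    then show ?thesis using full cache_hit by simp
  next
    case False
    then obtain e where e: "e \<in> A k \<sigma>" "e \<notin> A k (\<sigma> @ [z])" using full full_miss_evicts by blast
    then show ?thesis using cache_evict(2)[OF e] False full k cache_finite[of \<sigma>] by simp
  qed
qed

lemma at_most_one_above_missing:
  assumes "x \<in> set \<sigma>" "x \<notin> A k \<sigma>" "u \<in> A k \<sigma>" "v \<in> A k \<sigma>"
    and "(u, x) \<notin> R \<sigma>" "(v, x) \<notin> R \<sigma>"
  shows "u = v"
  using assms
proof (induction \<sigma> arbitrary: u v rule: rev_induct)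
  case Nil
  then show ?case by simp
next
  case (snoc z \<sigma>)
  have xz: "x \<noteq> z" using snoc.prems(2) cache_requested by auto
  then have x: "x \<in> set \<sigma>" using snoc.prems(1) by auto
  \<comment> \<open>Monotonicity in contrapositive form: as \<open>x\<close> is not the requested
    item, an old item strictly above \<open>x\<close> now was so before.\<close>
  have keep: "(w, x) \<notin> R \<sigma>" if "w \<in> A k \<sigma>" "(w, x) \<notin> R (\<sigma> @ [z])" for w
    using that order_append[of w \<sigma> x z] x xz cache_subset_set by blast
  show ?case
  proof (cases "x \<in> A k \<sigma>")
    case True
    have "w = z" if "w \<in> A k (\<sigma> @ [z])" "(w, x) \<notin> R (\<sigma> @ [z])" for w
      using that order_evict[OF True snoc.prems(2)] cache_evict(2)[OF True snoc.prems(2)] by blast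
    then show ?thesis using snoc.prems by blast
  next
    case xmiss: False
    show ?thesis
    proof (cases "z \<in> A k \<sigma>")
      case True
      then show ?thesis using snoc.prems snoc.IH[OF x xmiss] cache_hit keep by auto
    next
      case False
      obtain e where e: "e \<in> A k \<sigma>" "e \<notin> A k (\<sigma> @ [z])"
        using full_miss_evicts[OF full_if_missing[OF x xmiss] False] .
      \<comment> \<open>A survivor \<open>w\<close> above \<open>x\<close> would put the victim
        \<open>e\<close> above \<open>x\<close> too, so two cached items would have been above
        \<open>x\<close> before the request.\<close>
      have "w = z" if w: "w \<in> A k (\<sigma> @ [z])" "(w, x) \<notin> R (\<sigma> @ [z])" for w
      proof (rule ccontr)
        assume "w \<noteq> z"
        then have w': "w \<in> A k \<sigma>" "w \<noteq> e" using cache_evict(2)[OF e] w e by auto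
        then have "(e, x) \<notin> R (\<sigma> @ [z])" using order_evict[OF e] order_trans w(2) by blast
        then show False using snoc.IH[OF x xmiss w'(1) e(1)] keep w' w(2) e(1) by blast
      qed
      then show ?thesis using snoc.prems by blast
    qed
  qed
qed

text \<open>On a miss the victim cannot be \<open>x\<close>, since conformity would put
  \<open>y\<close> below it, so \<open>x\<close> was missing already. The victim then lies above
  \<open>y\<close>, and with \<open>y\<close> it makes two cached items above \<open>x\<close>
  before the request.\<close>

lemma hit_if_above_missing_kept:
  assumes x: "x \<in> set \<sigma>" "x \<notin> A k (\<sigma> @ [z])"
    and y: "y \<in> A k (\<sigma> @ [z])" "y \<noteq> z" "(y, x) \<notin> R (\<sigma> @ [z])"
  shows "z \<in> A k \<sigma>"
proof (rule ccontr)
  assume z: "z \<notin> A k \<sigma>"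
  have xz: "x \<noteq> z" using x(2) cache_requested by auto
  have y': "y \<in> A k \<sigma>" using y cache_append_subset by blast
  have "x \<noteq> y" using x y by auto
  then have xmiss: "x \<notin> A k \<sigma>" using order_evict[of x \<sigma> z y] x y y' by blast
  obtain e where e: "e \<in> A k \<sigma>" "e \<notin> A k (\<sigma> @ [z])"
    using full_miss_evicts[OF full_if_missing[OF x(1) xmiss] z] .
  have ey: "e \<noteq> y" using e y by auto
  then have "(e, x) \<notin> R (\<sigma> @ [z])" using order_evict[OF e y'] order_trans y(3) by blast
  then have "(e, x) \<notin> R \<sigma>" "(y, x) \<notin> R \<sigma>"
    using order_append[of _ \<sigma> x z] x xz y y' e cache_subset_set by blast+
  then show False using at_most_one_above_missing[OF x(1) xmiss e(1) y'] ey by blast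
qed

end

lemma stable: "stable_paging A"
  unfolding stable_paging_def
proof (intro allI ballI impI subsetI)
  fix \<tau> :: "'a list" and X z a b x
  let ?\<sigma> = "restrict_seq \<tau> X"
  assume z: "z \<in> X" and b: "(1::nat) \<le> b" and ab: "b < a"
    and "Out (A b) ?\<sigma> z \<inter> A a (\<tau> @ [z]) \<noteq> {}" and x: "x \<in> A b (?\<sigma> @ [z])"
  then obtain y where y: "y \<in> A b ?\<sigma>" "y \<notin> A b (?\<sigma> @ [z])" "y \<in> A a (\<tau> @ [z])"
    unfolding Out_def by blast
  have a: "1 \<le> a" using b ab by simp
  have sub: "set ?\<sigma> \<subseteq> set \<tau>" by (auto simp: restrict_seq_def)
  have \<sigma>z: "restrict_seq (\<tau> @ [z]) X = ?\<sigma> @ [z]" using z by (simp add: restrict_seq_def)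
  have zb: "z \<notin> A b ?\<sigma>" using cache_evict(1)[OF b y(1,2)] .
  show "x \<in> A a (\<tau> @ [z])"
  proof (rule ccontr)
    assume xa: "x \<notin> A a (\<tau> @ [z])"
    have xz: "x \<noteq> z" using xa cache_requested[OF a] by auto
    have xy: "x \<noteq> y" and yz: "y \<noteq> z" using x y zb by auto
    have xb: "x \<in> A b ?\<sigma>" using x xz cache_append_subset[OF b] by blast
    have x\<sigma>: "x \<in> set ?\<sigma>" and y\<sigma>: "y \<in> set ?\<sigma>" using xb y(1) cache_subset_set[OF b] by blast+
    then have x\<tau>: "x \<in> set \<tau>" and y\<tau>: "y \<in> set \<tau>" using sub by blast+
    have "(x, y) \<in> R (?\<sigma> @ [z])" using order_evict[OF b y(1,2) xb xy] .
    then have "(x, y) \<in> R (\<tau> @ [z])"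
      using order_restrict[of x "\<tau> @ [z]" X y] x\<sigma> y\<sigma> unfolding \<sigma>z by simp
    then have yx: "(y, x) \<notin> R (\<tau> @ [z])" using order_antisym xy by blast
    have za: "z \<in> A a \<tau>" using hit_if_above_missing_kept[OF a x\<tau> xa y(3) yz yx] .
    then have "x \<notin> A a \<tau>" and ya: "y \<in> A a \<tau>" using cache_hit[OF a] xa y(3) by auto
    \<comment> \<open>The comparison moves back before the request: afterwards \<open>A b\<close>
      holds \<open>z\<close>, and the final contradiction needs \<open>z\<close> missing
      there.\<close>
    moreover have yx\<tau>: "(y, x) \<notin> R \<tau>" using yx order_append x\<tau> y\<tau> xz by blast
    ultimately have zx: "(z, x) \<in> R \<tau>"
      using at_most_one_above_missing[OF a x\<tau>, of y z] za yz by blast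
    \<comment> \<open>Cached items have been requested, so \<open>z\<close> occurs in \<tau>, and by
      \<open>z \<in> X\<close> also in the restricted sequence.\<close>
    have z\<sigma>: "z \<in> set ?\<sigma>"
      using za cache_subset_set[OF a] z by (auto simp: restrict_seq_def)
    have "(x, z) \<notin> R \<tau>" "(y, z) \<notin> R \<tau>"
      using zx yx\<tau> xz order_antisym order_trans by blast+
    then have "(x, z) \<notin> R ?\<sigma>" "(y, z) \<notin> R ?\<sigma>"
      using order_restrict x\<sigma> y\<sigma> z\<sigma> by blast+
    then show False using at_most_one_above_missing[OF b z\<sigma> zb xb y(1)] xy by blast
  qed
qed

end

theorem theorem23:
  fixes A :: "'a::linorder paging" and R :: "'a list \<Rightarrow> 'a rel"
  assumes "paging_algorithm A"
    and "lazy A"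
    and "total_order_family R"
    and "conforms A R"
    and "monotone_family R"
    and "self_similar R"
  shows "stable_paging A"
proof -
  interpret monotone_conforming_paging A R
    using assms by unfold_locales
  show ?thesis by (rule stable)
qed

end
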